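(* Let $M$ be a matrix with non-negative real entries, let $t$ be an odd positive integer, and let $(x_1,y_1),\dots,(x_t,y_t)$ be positions in $M$ such that $x_1,\dots,x_t$ are pairwise distinct, $y_1,\dots,y_t$ are pairwise distinct, and $M_{x_iy_i}=0$ for all $i=1,\dots,t$. Then $$\sum_{i=1}^{t}\sum_{j=1}^{t} M_{x_iy_j}M_{x_jy_i} \le (t-1)\,\|M\|_\infty\,\|M\|_1 .$$
   Context: $\|M\|_\infty$ is the maximum of the $\ell^1$-norms of the rows of $M$, and $\|M\|_1=\|M^T\|_\infty$ is the maximum of the $\ell^1$-norms of the columns of $M$. *)

theory Defs
  imports "HOL-Analysis.Analysis"
begin

text \<open>A matrix of type \<open>real ^ 'n ^ 'm\<close> has rows indexed by \<open>'m\<close> and columns indexed by \<open>'n\<close>,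
  and \<open>M $ i $ j\<close> is the entry in row \<open>i\<close> and column \<open>j\<close>. Index types are finite and nonempty,
  so \<open>Max\<close> below is taken over a finite nonempty set.\<close>

definition mat_norm_inf :: "real ^ 'n ^ 'm \<Rightarrow> real" where
  "mat_norm_inf M = Max (range (\<lambda>i. \<Sum>j\<in>UNIV. \<bar>M $ i $ j\<bar>))"

definition mat_norm_1 :: "real ^ 'n ^ 'm \<Rightarrow> real" where
  "mat_norm_1 M = mat_norm_inf (transpose M)"

end

theory Submission
  imports Defs
begin

text \<open>Write \<open>A\<^sub>i\<^sub>j\<close> for \<open>M $ x i $ y j\<close>, a square matrix with zero diagonal, and \<open>R\<close>, \<open>C\<close> for the norms
  \<open>mat_norm_inf M\<close> and \<open>mat_norm_1 M\<close>, which bound its row and column sums. Symmetrising by the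
  geometric mean, \<open>G\<^sub>i\<^sub>j = sqrt (A\<^sub>i\<^sub>j A\<^sub>j\<^sub>i)\<close>, turns the left-hand side into the sum of all
  \<open>G\<^sub>i\<^sub>j\<^sup>2\<close>, and by Cauchy-Schwarz every row of \<open>G\<close> has sum at most \<open>s = sqrt (R C)\<close>. The arithmetic
  mean would only give the bound \<open>(R + C) / 2\<close> on the row sums, which is too weak when
  \<open>R \<noteq> C\<close>.

  View \<open>G\<close> as a weighted graph on \<open>t\<close> vertices in which every vertex has total weight at most
  \<open>s\<close>. A row contributes at most \<open>s\<^sup>2\<close> to the sum of squares, and one \<open>s\<^sup>2\<close> has to be saved
  altogether. The edges heavier than \<open>s / 2\<close> form a matching, and as \<open>t\<close> is odd, this matching
  misses some vertex \<open>v\<close> (\<open>odd_weighted_graph_light_vertex\<close>). Let \<open>w\<^sub>j \<le> s / 2\<close> be the weight of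
  the edge \<open>vj\<close>. What \<open>v\<close> contributes, the sum of the \<open>w\<^sub>j\<^sup>2\<close>, is paid for by the other
  rows: row \<open>j\<close> has to spend \<open>w\<^sub>j\<close> on \<open>v\<close>, so that its sum of squares is at most
  \<open>w\<^sub>j\<^sup>2 + (s - w\<^sub>j)\<^sup>2\<close>, which falls short of \<open>s\<^sup>2\<close> by \<open>2 w\<^sub>j (s - w\<^sub>j) \<ge> w\<^sub>j\<^sup>2\<close>. Hence
  the total is at most \<open>(t - 1) s\<^sup>2\<close> (\<open>odd_weighted_graph_sum_squares\<close>).\<close>

lemma even_card_fixed_point_free_involution:
  assumes "finite A" and "\<And>a. a \<in> A \<Longrightarrow> f a \<in> A"
    and "\<And>a. a \<in> A \<Longrightarrow> f (f a) = a" and "\<And>a. a \<in> A \<Longrightarrow> f a \<noteq> a"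
  shows "even (card A)"
proof -
  let ?orbits = "(\<lambda>a. {a, f a}) ` A"
  have "2 * card ?orbits = card (\<Union> ?orbits)"
  proof (rule card_partition)
    show "finite ?orbits" "finite (\<Union> ?orbits)" using assms(1) by auto
    show "card c = 2" if "c \<in> ?orbits" for c
      using that assms(4) by (auto simp: card_2_iff)
    show "c1 \<inter> c2 = {}" if c: "c1 \<in> ?orbits" "c2 \<in> ?orbits" "c1 \<noteq> c2" for c1 c2
    proof -
      obtain a b where ab: "a \<in> A" "b \<in> A" "c1 = {a, f a}" "c2 = {b, f b}" using c by auto
      then have "f (f a) = a" "f (f b) = b" using assms(3) by blast+
      with ab c(3) show ?thesis by (cases "a = b"; cases "a = f b"; cases "f a = b") auto
    qed
  qed
  moreover have "\<Union> ?orbits = A" using assms(2) by auto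
  ultimately show ?thesis by (metis dvd_triv_left)
qed

lemma sum_squares_le_square_sum:
  fixes g :: "'a \<Rightarrow> real"
  assumes "finite A" and "\<And>a. a \<in> A \<Longrightarrow> 0 \<le> g a"
  shows "(\<Sum>a\<in>A. (g a)\<^sup>2) \<le> (\<Sum>a\<in>A. g a)\<^sup>2"
  using assms
proof (induction A rule: finite_induct)
  case (insert a A)
  have "0 \<le> g a * sum g A"
    using insert.prems by (intro mult_nonneg_nonneg sum_nonneg) auto
  then show ?case
    using insert by (auto simp: power2_sum)
qed simp

text \<open>Two edges at a vertex cannot both be heavier than half of what the vertex may carry. So if
  every vertex had a heavy edge, its other end would be unique, and passing to it would be an
  involution without fixed points (there are no loops), impossible on an odd set.\<close>

lemma odd_weighted_graph_light_vertex:
  fixes G :: "'a \<Rightarrow> 'a \<Rightarrow> real"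
  assumes fin: "finite I" and odd: "odd (card I)"
    and nonneg: "\<And>i j. i \<in> I \<Longrightarrow> j \<in> I \<Longrightarrow> 0 \<le> G i j"
    and sym: "\<And>i j. i \<in> I \<Longrightarrow> j \<in> I \<Longrightarrow> G i j = G j i"
    and diag: "\<And>i. i \<in> I \<Longrightarrow> G i i = 0"
    and row: "\<And>i. i \<in> I \<Longrightarrow> (\<Sum>j\<in>I. G i j) \<le> s"
  obtains v where "v \<in> I" and "\<And>j. j \<in> I \<Longrightarrow> G v j \<le> s / 2"
proof -
  have "\<exists>v\<in>I. \<forall>j\<in>I. G v j \<le> s / 2"
  proof (rule ccontr)
    assume "\<not> ?thesis"
    then have "\<forall>v\<in>I. \<exists>j\<in>I. s / 2 < G v j" by (auto simp: not_le)
    then obtain f where f: "\<And>v. v \<in> I \<Longrightarrow> f v \<in> I \<and> s / 2 < G v (f v)" by metis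
    have unique: "j = k" if "v \<in> I" "j \<in> I" "k \<in> I" "s / 2 < G v j" "s / 2 < G v k" for v j k
    proof (rule ccontr)
      assume "j \<noteq> k"
      then have "G v j + G v k = (\<Sum>l\<in>{j, k}. G v l)" by simp
      also have "\<dots> \<le> (\<Sum>l\<in>I. G v l)"
        using that fin nonneg by (intro sum_mono2) auto
      finally show False using row[OF \<open>v \<in> I\<close>] that by linarith
    qed
    have "even (card I)"
    proof (rule even_card_fixed_point_free_involution[OF fin, of f])
      fix v assume v: "v \<in> I"
      show "f v \<in> I" using f v by blast
      show "f (f v) = v"
        using unique[of "f v" "f (f v)" v] f[OF v] f[of "f v"] v sym[of v "f v"] by auto
      have "0 \<le> s" using sum_nonneg[of I "G v"] nonneg v row[OF v] by fastforce
      then show "f v \<noteq> v" using f[OF v] diag[OF v] by auto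
    qed
    with odd show False by blast
  qed
  with that show thesis by blast
qed

text \<open>The factor \<open>card I - 1\<close> is attained by a matching of edges of weight \<open>s\<close> that misses one
  vertex. To reach it, the row of a light vertex \<open>v\<close> is distributed, entry by entry, over the
  rows of the other vertices, each of which can absorb its share within \<open>s\<^sup>2\<close>.\<close>

lemma odd_weighted_graph_sum_squares:
  fixes G :: "'a \<Rightarrow> 'a \<Rightarrow> real"
  assumes fin: "finite I" and odd: "odd (card I)"
    and nonneg: "\<And>i j. i \<in> I \<Longrightarrow> j \<in> I \<Longrightarrow> 0 \<le> G i j"
    and sym: "\<And>i j. i \<in> I \<Longrightarrow> j \<in> I \<Longrightarrow> G i j = G j i"
    and diag: "\<And>i. i \<in> I \<Longrightarrow> G i i = 0"
    and row: "\<And>i. i \<in> I \<Longrightarrow> (\<Sum>j\<in>I. G i j) \<le> s"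
  shows "(\<Sum>i\<in>I. \<Sum>j\<in>I. (G i j)\<^sup>2) \<le> (real (card I) - 1) * s\<^sup>2"
proof -
  obtain v where v: "v \<in> I" and light: "\<And>j. j \<in> I \<Longrightarrow> G v j \<le> s / 2"
    using odd_weighted_graph_light_vertex[OF assms] by blast
  let ?J = "I - {v}"
  have row_j: "(\<Sum>k\<in>I. (G j k)\<^sup>2) + (G v j)\<^sup>2 \<le> s\<^sup>2" if j: "j \<in> ?J" for j
  proof -
    let ?w = "G v j"
    have "(\<Sum>k\<in>I. G j k) = ?w + (\<Sum>k\<in>?J. G j k)"
      using fin v j sym by (simp add: sum.remove[of I v])
    then have rest: "(\<Sum>k\<in>?J. G j k) \<le> s - ?w" using row[of j] j by simp
    have "(\<Sum>k\<in>I. (G j k)\<^sup>2) = ?w\<^sup>2 + (\<Sum>k\<in>?J. (G j k)\<^sup>2)"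
      using fin v j sym by (simp add: sum.remove[of I v])
    also have "(\<Sum>k\<in>?J. (G j k)\<^sup>2) \<le> (\<Sum>k\<in>?J. G j k)\<^sup>2"
      using fin j nonneg by (intro sum_squares_le_square_sum) auto
    also have "\<dots> \<le> (s - ?w)\<^sup>2"
      using rest j nonneg by (intro power_mono sum_nonneg) auto
    finally have "(\<Sum>k\<in>I. (G j k)\<^sup>2) + ?w\<^sup>2 \<le> s\<^sup>2 - ?w * (2 * s - 3 * ?w)"
      by (simp add: power2_eq_square algebra_simps)
    \<comment> \<open>lightness of \<open>v\<close> enters here: it makes the second factor non-negative\<close>
    moreover have "0 \<le> ?w * (2 * s - 3 * ?w)"
      using light[of j] nonneg[OF v, of j] j by (intro mult_nonneg_nonneg) auto
    ultimately show ?thesis by linarith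
  qed
  have "(\<Sum>i\<in>I. \<Sum>j\<in>I. (G i j)\<^sup>2) = (\<Sum>j\<in>?J. (\<Sum>k\<in>I. (G j k)\<^sup>2) + (G v j)\<^sup>2)"
    using fin v diag
    by (simp add: sum.remove[of I v "\<lambda>i. \<Sum>j\<in>I. (G i j)\<^sup>2"] sum.remove[of I v "\<lambda>j. (G v j)\<^sup>2"]
        sum.distrib)
  also have "\<dots> \<le> (\<Sum>j\<in>?J. s\<^sup>2)" by (intro sum_mono row_j)
  also have "\<dots> = (real (card I) - 1) * s\<^sup>2"
  proof -
    have "card I \<ge> 1" using fin v by (metis card_0_eq empty_iff less_one not_less)
    then show ?thesis using fin v by simp
  qed
  finally show ?thesis .
qed

lemma submatrix_row_sum_le_mat_norm_inf:
  fixes M :: "real ^ 'n ^ 'm"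
  assumes nonneg: "\<And>i j. M $ i $ j \<ge> 0" and inj: "inj_on y I"
  shows "(\<Sum>j\<in>I. M $ i $ y j) \<le> mat_norm_inf M"
proof -
  have "(\<Sum>j\<in>I. M $ i $ y j) = (\<Sum>k\<in>y ` I. M $ i $ k)"
    using inj by (simp add: sum.reindex)
  also have "\<dots> \<le> (\<Sum>k\<in>UNIV. \<bar>M $ i $ k\<bar>)"
    using nonneg by (simp add: sum_mono2)
  also have "\<dots> \<le> mat_norm_inf M"
    unfolding mat_norm_inf_def by (intro Max_ge) auto
  finally show ?thesis .
qed

lemma submatrix_column_sum_le_mat_norm_1:
  fixes M :: "real ^ 'n ^ 'm"
  assumes nonneg: "\<And>i j. M $ i $ j \<ge> 0" and inj: "inj_on x I"
  shows "(\<Sum>i\<in>I. M $ x i $ j) \<le> mat_norm_1 M"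
  using submatrix_row_sum_le_mat_norm_inf[of "transpose M" x I j] assms
  by (simp add: mat_norm_1_def transpose_def)

theorem theorem5:
  fixes M :: "real ^ 'n ^ 'm" and t :: nat and x :: "nat \<Rightarrow> 'm" and y :: "nat \<Rightarrow> 'n"
  assumes nonneg: "\<And>i j. M $ i $ j \<ge> 0"
    and t_odd: "odd t"
    and x_distinct: "inj_on x {1..t}"
    and y_distinct: "inj_on y {1..t}"
    and zero: "\<And>i. i \<in> {1..t} \<Longrightarrow> M $ x i $ y i = 0"
  shows "(\<Sum>i=1..t. \<Sum>j=1..t. M $ x i $ y j * M $ x j $ y i)
           \<le> (real t - 1) * mat_norm_inf M * mat_norm_1 M"
proof -
  define G where "G i j = sqrt (M $ x i $ y j) * sqrt (M $ x j $ y i)" for i j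
  let ?R = "mat_norm_inf M" and ?C = "mat_norm_1 M"
  note row_sum = submatrix_row_sum_le_mat_norm_inf[OF nonneg y_distinct]
    and column_sum = submatrix_column_sum_le_mat_norm_1[OF nonneg x_distinct]
  have RC: "0 \<le> ?R" "0 \<le> ?C"
    using order_trans[OF sum_nonneg row_sum] order_trans[OF sum_nonneg column_sum] nonneg by blast+
  have "(\<Sum>i\<in>{1..t}. \<Sum>j\<in>{1..t}. (G i j)\<^sup>2) \<le> (real (card {1..t}) - 1) * (sqrt (?R * ?C))\<^sup>2"
  proof (rule odd_weighted_graph_sum_squares)
    fix i assume i: "i \<in> {1..t}"
    have "(\<Sum>j\<in>{1..t}. G i j)\<^sup>2
        \<le> (\<Sum>j\<in>{1..t}. (sqrt (M $ x i $ y j))\<^sup>2) * (\<Sum>j\<in>{1..t}. (sqrt (M $ x j $ y i))\<^sup>2)"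
      unfolding G_def by (rule Cauchy_Schwarz_ineq_sum)
    also have "\<dots> = (\<Sum>j\<in>{1..t}. M $ x i $ y j) * (\<Sum>j\<in>{1..t}. M $ x j $ y i)"
      using nonneg by simp
    also have "\<dots> \<le> ?R * ?C"
      using nonneg RC by (intro mult_mono row_sum column_sum sum_nonneg) auto
    finally show "(\<Sum>j\<in>{1..t}. G i j) \<le> sqrt (?R * ?C)" by (rule real_le_rsqrt)
    show "G i i = 0" using zero[OF i] by (simp add: G_def)
  qed (use t_odd nonneg in \<open>auto simp: G_def\<close>)
  then show ?thesis
    using nonneg RC by (simp add: G_def power_mult_distrib mult.assoc)
qed

end
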